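(* Let a Euclidean triangle have side lengths $a,b,c$, circumradius $R$, and inradius $r$. Then $$\frac Rr\ \ge\ \frac{abc+a^3+b^3+c^3}{2abc}$$ $$\ge\ \frac12\left(\frac ab+\frac ba+\frac ac+\frac ca+\frac bc+\frac cb\right)-1$$ $$\ge\ \frac13\left(\frac ab+\frac ba+\frac ac+\frac ca+\frac bc+\frac cb\right)$$ $$\ge\ \frac{(a+b)(a+c)(b+c)}{4abc}\ \ge\ 2.$$
   Context: Triangles are nondegenerate. *)

theory Defs
  imports "HOL-Analysis.Analysis"
begin

definition is_circumradius :: "real^2 \<Rightarrow> real^2 \<Rightarrow> real^2 \<Rightarrow> real \<Rightarrow> bool" where
  "is_circumradius A B C R \<longleftrightarrow> (\<exists>Z. {A, B, C} \<subseteq> sphere Z R)"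

text \<open>The inscribed circle is the circle inside the triangle that is tangent to all three sides.
  Since the disc lies inside the triangle, meeting a side in exactly one point is tangency (the
  circle cannot cross the side).\<close>

definition is_inradius :: "real^2 \<Rightarrow> real^2 \<Rightarrow> real^2 \<Rightarrow> real \<Rightarrow> bool" where
  "is_inradius A B C r \<longleftrightarrow> r > 0 \<and>
     (\<exists>Z. cball Z r \<subseteq> convex hull {A, B, C} \<and>
        (\<exists>P. sphere Z r \<inter> closed_segment B C = {P}) \<and>
        (\<exists>P. sphere Z r \<inter> closed_segment C A = {P}) \<and>
        (\<exists>P. sphere Z r \<inter> closed_segment A B = {P}))"

end

theory Submission
  imports Defs
begin

text \<open>
  Write \<open>D\<close> for twice the area of the triangle, \<open>s = a + b + c\<close>, \<open>q = a b c\<close> and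
  \<open>S = a\<^sup>3 + b\<^sup>3 + c\<^sup>3\<close>.

  The first inequality is Gerretsen's inequality in disguise, and Gerretsen's inequality holds because
  a squared distance is nonnegative: if the circumcentre is the origin, then the orthocentre is
  \<open>A + B + C\<close> and the incentre is \<open>(a A + b B + c C) / s\<close>, so \<open>s\<close> times their difference is
  \<open>(b + c) A + (c + a) B + (a + b) C\<close>. Since \<open>2 A \<bullet> B = 2 R\<^sup>2 - c\<^sup>2\<close>, and likewise for the other
  pairs, the squared norm of this vector is \<open>4 s\<^sup>2 R\<^sup>2 - s (q + S)\<close>, whence \<open>q + S \<le> 4 s R\<^sup>2\<close>
  (\<open>gerretsen_circumradius\<close>). With \<open>q = 2 D R\<close> (\<open>circumradius_doubled_area\<close>) and \<open>s r \<le> D\<close>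
  (\<open>inradius_doubled_area\<close>) this gives
  \<open>R / r \<ge> R s / D = 2 s R\<^sup>2 / q \<ge> (q + S) / (2 q)\<close>.

  The remaining inequalities hold for all positive \<open>a, b, c\<close>. Let
  \<open>T = a\<^sup>2 b + a b\<^sup>2 + a\<^sup>2 c + a c\<^sup>2 + b\<^sup>2 c + b c\<^sup>2\<close>, so that the sum of the six ratios is
  \<open>T / q\<close> and \<open>(a + b) (a + c) (b + c) = T + 2 q\<close>. Then the second inequality is Schur's inequality
  \<open>T \<le> S + 3 q\<close>, and the last three are all equivalent to \<open>6 q \<le> T\<close>.
\<close>

section \<open>Symmetric inequalities\<close>

text \<open>Schur's sum equals \<open>(x - y)\<^sup>2 (x + y - z) + z (x - z) (y - z)\<close>, which is visibly
  nonnegative when \<open>z\<close> is the least of the three.\<close>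

lemma schur_min:
  fixes x y z :: real
  assumes "0 \<le> z" "z \<le> x" "z \<le> y"
  shows "x^2*y + x*y^2 + x^2*z + x*z^2 + y^2*z + y*z^2 \<le> x^3 + y^3 + z^3 + 3*x*y*z"
proof -
  have "0 \<le> (x - y)^2 * (x + y - z) + z * ((x - z) * (y - z))"
    using assms by (intro add_nonneg_nonneg mult_nonneg_nonneg) auto
  also have "\<dots> = x^3 + y^3 + z^3 + 3*x*y*z
      - (x^2*y + x*y^2 + x^2*z + x*z^2 + y^2*z + y*z^2)"
    by (simp add: algebra_simps power2_eq_square power3_eq_cube)
  finally show ?thesis by simp
qed

lemma schur:
  fixes a b c :: real
  assumes "0 \<le> a" "0 \<le> b" "0 \<le> c"
  shows "a^2*b + a*b^2 + a^2*c + a*c^2 + b^2*c + b*c^2 \<le> a^3 + b^3 + c^3 + 3*a*b*c"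
proof -
  consider "c \<le> a" "c \<le> b" | "b \<le> a" "b \<le> c" | "a \<le> b" "a \<le> c" by linarith
  then show ?thesis
  proof cases
    case 1
    then show ?thesis using schur_min[of c a b] assms by simp
  next
    case 2
    then show ?thesis using schur_min[of b a c] assms by (simp add: algebra_simps)
  next
    case 3
    then show ?thesis using schur_min[of a b c] assms by (simp add: algebra_simps)
  qed
qed

lemma six_products_le:
  fixes a b c :: real
  assumes "0 \<le> a" "0 \<le> b" "0 \<le> c"
  shows "6*a*b*c \<le> a^2*b + a*b^2 + a^2*c + a*c^2 + b^2*c + b*c^2"
proof -
  have "0 \<le> a * (b - c)^2 + b * (c - a)^2 + c * (a - b)^2"
    using assms by simp
  also have "\<dots> = a^2*b + a*b^2 + a^2*c + a*c^2 + b^2*c + b*c^2 - 6*a*b*c"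
    by (simp add: algebra_simps power2_eq_square)
  finally show ?thesis by simp
qed

lemma sum_of_ratios:
  fixes a b c :: real
  assumes "a > 0" "b > 0" "c > 0"
  shows "a/b + b/a + a/c + c/a + b/c + c/b
    = (a^2*b + a*b^2 + a^2*c + a*c^2 + b^2*c + b*c^2) / (a*b*c)"
  using assms by (simp add: field_simps power2_eq_square)

section \<open>The circumscribed circle\<close>

text \<open>The norm that is expanded is that of \<open>a + b + c\<close> times the vector from the incentre to
  the orthocentre, written with the circumcentre \<open>Z\<close> as origin.\<close>

lemma gerretsen_circumradius:
  fixes A B C Z :: "'a::real_inner"
  defines "a \<equiv> dist B C" and "b \<equiv> dist C A" and "c \<equiv> dist A B"
  assumes sphere: "{A, B, C} \<subseteq> sphere Z R" and "A \<noteq> B"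
  shows "a*b*c + a^3 + b^3 + c^3 \<le> 4 * (a + b + c) * R^2"
proof -
  define u v w where "u = A - Z" and "v = B - Z" and "w = C - Z"
  have norms: "u \<bullet> u = R^2" "v \<bullet> v = R^2" "w \<bullet> w = R^2"
    using sphere by (auto simp: u_def v_def w_def dist_norm norm_minus_commute
        simp flip: power2_norm_eq_inner)
  have "c^2 = (u - v) \<bullet> (u - v)" "a^2 = (v - w) \<bullet> (v - w)" "b^2 = (w - u) \<bullet> (w - u)"
    by (simp_all add: a_def b_def c_def u_def v_def w_def dist_norm flip: power2_norm_eq_inner)
  then have prods: "u \<bullet> v = R^2 - c^2/2" "v \<bullet> w = R^2 - a^2/2" "u \<bullet> w = R^2 - b^2/2"
    using norms by (simp_all add: inner_diff inner_commute field_simps)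
  define X where "X = (b + c) *\<^sub>R u + (c + a) *\<^sub>R v + (a + b) *\<^sub>R w"
  have "X \<bullet> X = (b + c)^2 * (u \<bullet> u) + (c + a)^2 * (v \<bullet> v) + (a + b)^2 * (w \<bullet> w)
      + 2 * (b + c) * (c + a) * (u \<bullet> v) + 2 * (c + a) * (a + b) * (v \<bullet> w)
      + 2 * (b + c) * (a + b) * (u \<bullet> w)"
    unfolding X_def
    by (simp add: inner_add_left inner_add_right inner_commute power2_eq_square algebra_simps)
  also have "\<dots> = (a + b + c) * (4 * (a + b + c) * R^2 - (a*b*c + a^3 + b^3 + c^3))"
    unfolding norms prods by (simp add: field_simps power2_eq_square power3_eq_cube)
  finally have "0 \<le> (a + b + c) * (4 * (a + b + c) * R^2 - (a*b*c + a^3 + b^3 + c^3))"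
    using inner_ge_zero[of X] by simp
  moreover have "a + b + c > 0"
    using \<open>A \<noteq> B\<close> by (simp add: a_def b_def c_def add_nonneg_pos)
  ultimately show ?thesis
    by (simp add: zero_le_mult_iff)
qed

definition doubled_area :: "real^2 \<Rightarrow> real^2 \<Rightarrow> real^2 \<Rightarrow> real" where
  "doubled_area A B C = \<bar>(B$1 - A$1) * (C$2 - A$2) - (B$2 - A$2) * (C$1 - A$1)\<bar>"

text \<open>Take \<open>A\<close> as origin and let \<open>p, q, z\<close> be the positions of \<open>B, C\<close> and the centre. That \<open>z\<close> is
  equidistant from \<open>0, p, q\<close> amounts to the linear equations \<open>2 z \<bullet> p = |p|\<^sup>2\<close> and
  \<open>2 z \<bullet> q = |q|\<^sup>2\<close>, and Cramer's rule shows that \<open>2 D z\<close> is, up to sign, a quarter turn of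
  \<open>|p|\<^sup>2 q - |q|\<^sup>2 p\<close>. This vector has norm \<open>|p| |q| |p - q|\<close>.\<close>

lemma circumradius_doubled_area:
  fixes A B C Z :: "real^2"
  assumes sphere: "{A, B, C} \<subseteq> sphere Z R"
  shows "2 * doubled_area A B C * R = dist B C * dist C A * dist A B"
proof -
  define p1 p2 q1 q2 z1 z2 where
    "p1 = B$1 - A$1" and "p2 = B$2 - A$2" and "q1 = C$1 - A$1" and "q2 = C$2 - A$2"
    and "z1 = Z$1 - A$1" and "z2 = Z$2 - A$2"
  note coords = p1_def p2_def q1_def q2_def z1_def z2_def
  define d where "d = p1*q2 - p2*q1"
  have dist2: "(dist X Y)^2 = (X$1 - Y$1)^2 + (X$2 - Y$2)^2" for X Y :: "real^2"
    by (simp add: dist_vec_def L2_set_def sum_2 dist_real_def)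
  have radii: "dist Z A = R" "dist Z B = R" "dist Z C = R" using sphere by auto
  have R2: "R^2 = z1^2 + z2^2"
    using dist2[of Z A] radii by (simp add: coords)
  have "R^2 = (z1 - p1)^2 + (z2 - p2)^2" "R^2 = (z1 - q1)^2 + (z2 - q2)^2"
    using dist2[of Z B] dist2[of Z C] radii by (simp_all add: coords)
  then have equidistant: "2 * (z1*p1 + z2*p2) = p1^2 + p2^2" "2 * (z1*q1 + z2*q2) = q1^2 + q2^2"
    using R2 by (simp_all add: power2_diff algebra_simps)
  have cramer1: "2 * d * z1 = (p1^2 + p2^2) * q2 - (q1^2 + q2^2) * p2"
    unfolding d_def equidistant[symmetric] by (simp add: algebra_simps)
  have cramer2: "2 * d * z2 = (q1^2 + q2^2) * p1 - (p1^2 + p2^2) * q1"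
    unfolding d_def equidistant[symmetric] by (simp add: algebra_simps)
  have "(2 * doubled_area A B C * R)^2 = 4 * d^2 * R^2"
    by (simp add: doubled_area_def d_def coords power_mult_distrib)
  also have "\<dots> = (2 * d * z1)^2 + (2 * d * z2)^2"
    by (simp add: R2 algebra_simps power_mult_distrib)
  also have "\<dots> = ((p1 - q1)^2 + (p2 - q2)^2) * (q1^2 + q2^2) * (p1^2 + p2^2)"
    unfolding cramer1 cramer2 by (simp add: algebra_simps power2_eq_square)
  also have "\<dots> = (dist B C * dist C A * dist A B)^2"
    by (simp add: power_mult_distrib dist2 coords power2_commute)
  finally show ?thesis
    using radii(1) by (auto intro!: power2_eq_imp_eq simp: doubled_area_def)
qed

section \<open>The inscribed circle\<close>

text \<open>The inequality of the half-space is tested at the point of the ball that lies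
  furthest in the direction of the normal.\<close>

lemma cball_subset_halfspace:
  fixes n Z :: "'a::real_inner"
  assumes "cball Z r \<subseteq> {X. n \<bullet> X \<le> m}" and "0 \<le> r"
  shows "n \<bullet> Z + r * norm n \<le> m"
proof (cases "n = 0")
  case True
  have "Z \<in> cball Z r" using \<open>0 \<le> r\<close> by simp
  then have "n \<bullet> Z \<le> m" using assms(1) by blast
  then show ?thesis using True by simp
next
  case False
  define X where "X = Z + (r / norm n) *\<^sub>R n"
  have "X \<in> cball Z r"
    using False \<open>0 \<le> r\<close> by (simp add: X_def dist_norm)
  then have "n \<bullet> X \<le> m" using assms by auto
  moreover have "n \<bullet> X = n \<bullet> Z + r * norm n"
    using False by (simp add: X_def inner_add_right power2_eq_square flip: power2_norm_eq_inner)
  ultimately show ?thesis by simp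
qed

text \<open>Twice the area of the triangle \<open>A B Z\<close>, signed so that it is nonnegative if \<open>Z\<close> is
  on the same side of \<open>A B\<close> as \<open>C\<close>, is at least \<open>r |A B|\<close>, as its height on \<open>A B\<close> is at
  least \<open>r\<close>. The factor \<open>\<sigma>\<close> is the orientation of \<open>A B C\<close>.\<close>

lemma side_times_inner_radius:
  fixes A B C Z :: "real^2"
  assumes ball: "cball Z r \<subseteq> convex hull {A, B, C}" and "0 \<le> r" and "\<bar>\<sigma>\<bar> = 1"
    and orientation: "0 \<le> \<sigma> * ((B$1 - A$1) * (C$2 - A$2) - (B$2 - A$2) * (C$1 - A$1))"
  shows "r * dist A B \<le> \<sigma> * ((B$1 - A$1) * (Z$2 - A$2) - (B$2 - A$2) * (Z$1 - A$1))"
proof -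
  \<comment> \<open>the normal of \<open>A B\<close> that points away from \<open>C\<close>, with the length of \<open>A B\<close>\<close>
  define n :: "real^2" where "n = \<sigma> *\<^sub>R vector [B$2 - A$2, A$1 - B$1]"
  have n_inner: "n \<bullet> X - n \<bullet> A
      = - \<sigma> * ((B$1 - A$1) * (X$2 - A$2) - (B$2 - A$2) * (X$1 - A$1))" for X
    by (simp add: n_def inner_vec_def sum_2 algebra_simps)
  have norm_n: "norm n = dist A B"
    using \<open>\<bar>\<sigma>\<bar> = 1\<close> unfolding n_def norm_scaleR
    by (simp add: norm_vec_def dist_vec_def L2_set_def sum_2 dist_real_def
        power2_commute[of "B$2" "A$2"] add.commute)
  have "convex hull {A, B, C} \<subseteq> {X. n \<bullet> X \<le> n \<bullet> A}"
  proof (rule hull_minimal)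
    show "{A, B, C} \<subseteq> {X. n \<bullet> X \<le> n \<bullet> A}"
      using n_inner[of B] n_inner[of C] orientation by auto
  qed (rule convex_halfspace_le)
  then have "n \<bullet> Z + r * norm n \<le> n \<bullet> A"
    using ball \<open>0 \<le> r\<close> by (intro cball_subset_halfspace) auto
  then show ?thesis using n_inner[of Z] norm_n by simp
qed

text \<open>The signed areas of \<open>A B Z\<close>, \<open>B C Z\<close> and \<open>C A Z\<close> add up to that of \<open>A B C\<close>.\<close>

lemma inradius_doubled_area:
  fixes A B C Z :: "real^2"
  assumes ball: "cball Z r \<subseteq> convex hull {A, B, C}" and "0 \<le> r"
  shows "(dist B C + dist C A + dist A B) * r \<le> doubled_area A B C"
proof -
  define d where "d = (B$1 - A$1) * (C$2 - A$2) - (B$2 - A$2) * (C$1 - A$1)"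
  \<comment> \<open>not \<open>sgn d\<close>, which vanishes for collinear points\<close>
  define \<sigma> :: real where "\<sigma> = (if d < 0 then -1 else 1)"
  have \<sigma>: "\<bar>\<sigma>\<bar> = 1" "0 \<le> \<sigma> * d" "\<sigma> * d = doubled_area A B C"
    by (auto simp: \<sigma>_def d_def doubled_area_def)
  have d_cyclic: "d = (C$1 - B$1) * (A$2 - B$2) - (C$2 - B$2) * (A$1 - B$1)"
    "d = (A$1 - C$1) * (B$2 - C$2) - (A$2 - C$2) * (B$1 - C$1)"
    by (simp_all add: d_def algebra_simps)
  have "r * dist A B \<le> \<sigma> * ((B$1 - A$1) * (Z$2 - A$2) - (B$2 - A$2) * (Z$1 - A$1))"
    using ball \<open>0 \<le> r\<close> \<sigma> by (intro side_times_inner_radius) (auto simp: d_def)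
  moreover have "r * dist B C \<le> \<sigma> * ((C$1 - B$1) * (Z$2 - B$2) - (C$2 - B$2) * (Z$1 - B$1))"
    using ball \<open>0 \<le> r\<close> \<sigma>(1,2) unfolding d_cyclic(1)
    by (intro side_times_inner_radius[where C = A]) (simp_all add: insert_commute)
  moreover have "r * dist C A \<le> \<sigma> * ((A$1 - C$1) * (Z$2 - C$2) - (A$2 - C$2) * (Z$1 - C$1))"
    using ball \<open>0 \<le> r\<close> \<sigma>(1,2) unfolding d_cyclic(2)
    by (intro side_times_inner_radius[where C = B]) (simp_all add: insert_commute)
  moreover have "\<sigma> * ((B$1 - A$1) * (Z$2 - A$2) - (B$2 - A$2) * (Z$1 - A$1))
      + \<sigma> * ((C$1 - B$1) * (Z$2 - B$2) - (C$2 - B$2) * (Z$1 - B$1))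
      + \<sigma> * ((A$1 - C$1) * (Z$2 - C$2) - (A$2 - C$2) * (Z$1 - C$1)) = \<sigma> * d"
    by (simp add: d_def algebra_simps)
  ultimately show ?thesis using \<sigma>(3) by (simp add: algebra_simps)
qed

section \<open>The chain of inequalities\<close>

theorem theorem4p1:
  fixes A B C :: "real^2" and a b c R r :: real
  assumes nondegenerate: "\<not> collinear {A, B, C}"
    and sides: "a = dist B C" "b = dist C A" "c = dist A B"
    and circumradius: "is_circumradius A B C R"
    and inradius: "is_inradius A B C r"
  shows "R / r \<ge> (a * b * c + a ^ 3 + b ^ 3 + c ^ 3) / (2 * a * b * c) \<and>
    (a * b * c + a ^ 3 + b ^ 3 + c ^ 3) / (2 * a * b * c)
      \<ge> 1 / 2 * (a / b + b / a + a / c + c / a + b / c + c / b) - 1 \<and>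
    1 / 2 * (a / b + b / a + a / c + c / a + b / c + c / b) - 1
      \<ge> 1 / 3 * (a / b + b / a + a / c + c / a + b / c + c / b) \<and>
    1 / 3 * (a / b + b / a + a / c + c / a + b / c + c / b)
      \<ge> (a + b) * (a + c) * (b + c) / (4 * a * b * c) \<and>
    (a + b) * (a + c) * (b + c) / (4 * a * b * c) \<ge> 2"
proof -
  have "A \<noteq> B" "B \<noteq> C" "C \<noteq> A"
    using nondegenerate by (auto simp: insert_commute)
  then have pos: "a > 0" "b > 0" "c > 0" using sides by auto
  obtain Z where Z: "{A, B, C} \<subseteq> sphere Z R"
    using circumradius by (auto simp: is_circumradius_def)
  obtain I where I: "cball I r \<subseteq> convex hull {A, B, C}" and "r > 0"
    using inradius by (auto simp: is_inradius_def)
  define D where "D = doubled_area A B C"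
  define q S T where "q = a*b*c" and "S = a^3 + b^3 + c^3"
    and "T = a^2*b + a*b^2 + a^2*c + a*c^2 + b^2*c + b*c^2"
  have "q > 0" using pos by (simp add: q_def)
  have gerretsen: "q + S \<le> 4 * (a + b + c) * R^2"
    using gerretsen_circumradius[OF Z \<open>A \<noteq> B\<close>] by (simp add: q_def S_def sides)
  have q_area: "2 * D * R = q"
    using circumradius_doubled_area[OF Z] by (simp add: D_def q_def sides)
  have r_area: "(a + b + c) * r \<le> D"
    using inradius_doubled_area[OF I] \<open>r > 0\<close> by (simp add: D_def sides)
  have "0 < (a + b + c) * r" using pos \<open>r > 0\<close> by simp
  with r_area have "D > 0" by linarith
  then have "R > 0" using q_area \<open>q > 0\<close> by (metis zero_less_mult_pos mult_pos_pos zero_less_numeral)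
  have "(q + S) / (2*q) \<le> 4 * (a + b + c) * R^2 / (2*q)"
    using gerretsen \<open>q > 0\<close> by (simp add: divide_right_mono)
  also have "\<dots> = (a + b + c) * R / D"
    using \<open>R > 0\<close> \<open>D > 0\<close> by (simp add: field_simps power2_eq_square flip: q_area)
  also have "\<dots> \<le> R / r"
    using mult_right_mono[OF r_area, of R] \<open>R > 0\<close> \<open>r > 0\<close> \<open>D > 0\<close> by (simp add: field_simps)
  finally have first: "(q + S) / (2*q) \<le> R / r" .
  have ratios: "a/b + b/a + a/c + c/a + b/c + c/b = T / q"
    using sum_of_ratios[OF pos] by (simp add: T_def q_def)
  have product: "(a + b) * (a + c) * (b + c) = T + 2*q"
    by (simp add: T_def q_def algebra_simps power2_eq_square)
  have "T \<le> S + 3*q"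
    using schur[of a b c] pos by (simp add: T_def S_def q_def)
  then have "(T - 2*q) / (2*q) \<le> (q + S) / (2*q)"
    using \<open>q > 0\<close> by (intro divide_right_mono) auto
  then have second: "1/2 * (T/q) - 1 \<le> (q + S) / (2*q)"
    using \<open>q > 0\<close> by (simp add: diff_divide_distrib)
  have "6*q \<le> T"
    using six_products_le[of a b c] pos by (simp add: T_def q_def)
  then have rest: "1/3 * (T/q) \<le> 1/2 * (T/q) - 1" "(T + 2*q) / (4*q) \<le> 1/3 * (T/q)"
    "2 \<le> (T + 2*q) / (4*q)"
    using \<open>q > 0\<close> by (simp_all add: field_simps)
  have denominators: "2 * a * b * c = 2*q" "4 * a * b * c = 4*q"
    and numerator: "a * b * c + a^3 + b^3 + c^3 = q + S"
    by (simp_all add: q_def S_def)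
  show ?thesis
    unfolding ratios product denominators numerator using first second rest by blast
qed

end
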